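(* There is an absolute constant $C>0$ such that the following holds. Let $p$ be a prime, $q$ a positive integer, and $A\in\{-1,1\}^{q\times q}$ a matrix with exactly half of its entries equal to $1$. Let $k<n$ be positive integers, $\delta\in(0,1/2)$, and suppose the probabilistic Boolean rank of $\mathrm{Maj}^{(k)}(A)$ for error rate $\delta$ is $r$. Then $$\mathcal{R}^{\mathrm{bool},p}_{\mathrm{Maj}^{(n)}(A)}(r)\;\le\;q^{2n}\left(\frac12-C(1-2\delta)\frac{\sqrt{k}}{\sqrt{n}}\right).$$
   Context: $\mathbb{F}_p$ is the field with $p$ elements. For $x\in\mathbb{F}_p$ define $\mathrm{bool}(x)=1$ if $x=1$ in $\mathbb{F}_p$ and $\mathrm{bool}(x)=-1$ otherwise. For $B\in\{-1,1\}^{N\times N}$ and integer $r\ge0$, the Boolean rigidity $\mathcal{R}^{\mathrm{bool},p}_{B}(r)$ is the minimum, over all $L\in\mathbb{F}_p^{N\times N}$ with $\mathbb{F}_p$-rank at most $r$, of the number of pairs $(i,j)$ with $B[i,j]\neq\mathrm{bool}(L[i,j])$. The probabilistic Boolean rank of $B$ for error rate $\delta$ is the minimum $r$ such that there is a probability distribution $\mathcal{L}$ over matrices in $\mathbb{F}_p^{N\times N}$ of rank at most $r$ with $\Pr_{L\sim\mathcal{L}}[\mathrm{bool}(L[i,j])\neq B[i,j]]\le\delta$ for every $(i,j)$. The majority function $\mathrm{Maj}:\{-1,1\}^m\to\{-1,1\}$ is $1$ if $a_1+\dots+a_m\ge0$ and $-1$ otherwise. The Majority power $\mathrm{Maj}^{(n)}(A)$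 is the $q^n\times q^n$ matrix indexed by $\{0,\dots,q-1\}^n$ with $\mathrm{Maj}^{(n)}(A)[x,y]=\mathrm{Maj}(A[x_1,y_1],\dots,A[x_n,y_n])$. *)

theory Defs
  imports
    "HOL-Probability.Probability"
    "HOL-Number_Theory.Residues"
    "Jordan_Normal_Form.DL_Rank"
begin

text \<open>
  The constant of the theorem must not depend on \<open>p\<close>, so the field with \<open>p\<close> elements cannot be a
  type; it is the HOL-Algebra ring \<open>residue_ring p\<close> with carrier \<open>{0..p-1}\<close>. A square matrix with
  finite index set \<open>I\<close> is a function of a row and a column index; matrices over the field are
  extensional outside \<open>I\<close>, so that there are only finitely many of them.
\<close>

abbreviation GFp :: "nat \<Rightarrow> int ring" where
  "GFp p \<equiv> residue_ring (int p)"

definition fp_mats :: "nat \<Rightarrow> 'i set \<Rightarrow> ('i \<Rightarrow> 'i \<Rightarrow> int) set" where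
  "fp_mats p I = I \<rightarrow>\<^sub>E (I \<rightarrow>\<^sub>E carrier (GFp p))"

definition mat_column :: "'i set \<Rightarrow> ('i \<Rightarrow> 'i \<Rightarrow> int) \<Rightarrow> 'i \<Rightarrow> 'i \<Rightarrow> int" where
  "mat_column I L j = (\<lambda>i\<in>I. L i j)"

text \<open>
  The dimension of the column space, inside the coordinate space of functions from \<open>I\<close> to the
  field; this is the definition of \<open>vec_space.rank\<close> transferred to a field given by a carrier.
\<close>

definition fp_rank :: "nat \<Rightarrow> 'i set \<Rightarrow> ('i \<Rightarrow> 'i \<Rightarrow> int) \<Rightarrow> nat" where
  "fp_rank p I L =
     (let V = ring.func_space (GFp p) I
      in vectorspace.dim (GFp p)
           (V\<lparr>carrier := LinearCombinations.module.span (GFp p) V (mat_column I L ` I)\<rparr>))"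

definition bool_sign :: "nat \<Rightarrow> int \<Rightarrow> int" where
  "bool_sign p x = (if x = \<one>\<^bsub>GFp p\<^esub> then 1 else -1)"

definition bool_rigidity :: "nat \<Rightarrow> 'i set \<Rightarrow> ('i \<Rightarrow> 'i \<Rightarrow> int) \<Rightarrow> nat \<Rightarrow> nat" where
  "bool_rigidity p I B r =
     (LEAST e. \<exists>L\<in>fp_mats p I. fp_rank p I L \<le> r \<and>
        e = card {(i, j). i \<in> I \<and> j \<in> I \<and> B i j \<noteq> bool_sign p (L i j)})"

definition prob_bool_rank :: "nat \<Rightarrow> 'i set \<Rightarrow> ('i \<Rightarrow> 'i \<Rightarrow> int) \<Rightarrow> real \<Rightarrow> nat" where
  "prob_bool_rank p I B \<delta> =
     (LEAST r. \<exists>D :: ('i \<Rightarrow> 'i \<Rightarrow> int) pmf.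
        set_pmf D \<subseteq> {L \<in> fp_mats p I. fp_rank p I L \<le> r} \<and>
        (\<forall>i\<in>I. \<forall>j\<in>I. measure_pmf.prob D {L. bool_sign p (L i j) \<noteq> B i j} \<le> \<delta>))"

definition maj :: "int list \<Rightarrow> int" where
  "maj as = (if sum_list as \<ge> 0 then 1 else -1)"

definition tuples :: "nat \<Rightarrow> nat \<Rightarrow> nat list set" where
  "tuples q n = {x. length x = n \<and> set x \<subseteq> {..<q}}"

definition maj_power :: "nat \<Rightarrow> (nat \<Rightarrow> nat \<Rightarrow> int) \<Rightarrow> nat list \<Rightarrow> nat list \<Rightarrow> int" where
  "maj_power n A x y = maj (map (\<lambda>i. A (x ! i) (y ! i)) [0..<n])"

end

theory Submission
  imports Defs
begin

text \<open>
  A matrix \<open>L\<close> of the distribution for the \<open>k\<close>-th majority power is pulled back along truncation of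
  tuples to their first \<open>k\<close> entries; this does not increase the rank. Since \<open>A\<close> is balanced, for
  uniformly random indices the partial sums of the entries of \<open>A\<close> form a simple random walk. Given
  that the first \<open>k\<close> steps sum to \<open>s\<close>, the expected majority of all \<open>n\<close> steps never has the opposite
  sign to the majority of the first \<open>k\<close>, so the error \<open>\<delta>\<close> only costs a factor \<open>1 - 2\<delta>\<close>, and for \<open>s \<ge> 0\<close> it equals the probability that the remaining walk \<open>T\<close> satisfies \<open>|T| \<le> s\<close>.
  By unimodality and Chebyshev this is at least \<open>min (s / (4\<surd>n)) (3/4)\<close>, and the second and fourth
  moments of the walk show that on average this is at least of order \<open>\<surd>k / \<surd>n\<close>. Some matrix in
  the support of the distribution is at least as good as the average.
\<close>

section \<open>Rank of a pulled back matrix\<close>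

text \<open>The whole carrier is a finite spanning set. Rank-nullity and monotonicity of dimension
  both ask for finite dimension.\<close>

lemma (in vectorspace) fin_dim_if_finite_carrier:
  assumes "finite (carrier V)"
  shows "fin_dim"
  unfolding fin_dim_def
  using assms in_own_span[of "carrier V"] span_is_subset2[of "carrier V"] by blast

text \<open>Precomposition with \<open>\<pi>\<close> is linear and sends column
  \<open>\<pi> y\<close> of \<open>L\<close> to column \<open>y\<close> of the new matrix. The new
  column space therefore lies in a linear image of the old one.\<close>

lemma fp_rank_pullback_le:
  assumes p: "prime p" and fin: "finite I" "finite J" and \<pi>: "\<pi> \<in> J \<rightarrow> I" and L: "L \<in> fp_mats p I"
  shows "fp_rank p J (\<lambda>x\<in>J. \<lambda>y\<in>J. L (\<pi> x) (\<pi> y)) \<le> fp_rank p I L"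
proof -
  interpret residues_prime p "GFp p" by unfold_locales (use p in auto)
  define F where "F = func_space I"
  define G where "G = func_space J"
  have vsF: "vectorspace (GFp p) F" and vsG: "vectorspace (GFp p) G"
    unfolding F_def G_def using func_space_is_module is_field by (auto simp: vectorspace_def module_def)
  interpret F: vectorspace "GFp p" F by (rule vsF)
  interpret G: vectorspace "GFp p" G by (rule vsG)
  define S where "S = mat_column I L ` I"
  define S' where "S' = mat_column J (\<lambda>x\<in>J. \<lambda>y\<in>J. L (\<pi> x) (\<pi> y)) ` J"
  define T where "T = (\<lambda>f :: _ \<Rightarrow> int. \<lambda>x\<in>J. f (\<pi> x))"
  have carF: "carrier F = I \<rightarrow>\<^sub>E carrier (GFp p)" and carG: "carrier G = J \<rightarrow>\<^sub>E carrier (GFp p)"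
    unfolding F_def G_def func_space_def by auto
  have finF: "finite (carrier F)" and finG: "finite (carrier G)"
    unfolding carF carG using fin by (auto intro!: finite_PiE)
  have S: "S \<subseteq> carrier F"
    unfolding S_def carF mat_column_def using L by (auto simp: fp_mats_def PiE_iff)
  have subS: "subspace (GFp p) (F.span S) F"
    using F.span_is_submodule[OF S] vsF by (simp add: subspace_def)
  have spanS: "F.span S \<subseteq> carrier F" by (rule F.span_is_subset2[OF S])
  have vsS: "vectorspace (GFp p) (F.span_vs S)"
    by (rule F.subspace_is_vs[OF subS])
  have hom: "T \<in> module_hom (GFp p) (F.span_vs S) G"
    unfolding module_hom_def
    using spanS \<pi> unfolding carF
    by (auto simp: T_def F_def G_def func_space_def PiE_iff extensional_def fun_eq_iff Pi_iff
        restrict_def)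
  \<comment> \<open>The domain is the column space of \<open>L\<close>, not all of \<open>F\<close>,
    so that rank-nullity bounds the dimension of the image by the rank of \<open>L\<close>.\<close>
  interpret T: linear_map "GFp p" "F.span_vs S" G T
    using vsS vsG hom by (auto simp: linear_map_def mod_hom_def mod_hom_axioms_def vectorspace_def)
  have fdS: "vectorspace.fin_dim (GFp p) (F.span_vs S)"
    by (rule vectorspace.fin_dim_if_finite_carrier[OF vsS]) (use finF spanS finite_subset in auto)
  have im: "subspace (GFp p) T.im G" by (rule T.imT_is_subspace)
  have S': "S' \<subseteq> T.im"
  proof
    fix v assume "v \<in> S'"
    then obtain y where y: "y \<in> J" "v = mat_column J (\<lambda>x\<in>J. \<lambda>y\<in>J. L (\<pi> x) (\<pi> y)) y"
      by (auto simp: S'_def)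
    then have "v = T (mat_column I L (\<pi> y))"
      using \<pi> by (auto simp: T_def mat_column_def fun_eq_iff)
    moreover have "mat_column I L (\<pi> y) \<in> F.span S"
      using F.in_own_span[OF S] y \<pi> by (auto simp: S_def)
    ultimately show "v \<in> T.im" by (auto simp: T.im_def)
  qed
  have imG: "T.im \<subseteq> carrier G" using im by (simp add: subspace_def submodule_def)
  have sub: "subspace (GFp p) (G.span S') G"
    using G.span_is_submodule[of S'] S' imG vsG by (auto simp: subspace_def)
  have "G.span S' \<subseteq> T.im"
    by (rule G.span_is_subset[OF S']) (use im in \<open>simp add: subspace_def\<close>)
  then have sub': "subspace (GFp p) (G.span S') (G.vs T.im)"
    by (rule G.nested_subspaces[OF im sub])
  have vsI: "vectorspace (GFp p) (G.vs T.im)" by (rule G.subspace_is_vs[OF im])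
  have fdI: "vectorspace.fin_dim (GFp p) (G.vs T.im)"
    by (rule vectorspace.fin_dim_if_finite_carrier[OF vsI]) (use finG imG finite_subset in auto)
  have fdS': "vectorspace.fin_dim (GFp p) (G.span_vs S')"
    by (rule vectorspace.fin_dim_if_finite_carrier[OF G.subspace_is_vs[OF sub]])
      (use finite_subset[OF _ finG] imG \<open>G.span S' \<subseteq> T.im\<close> in auto)
  have "vectorspace.dim (GFp p) (G.span_vs S') \<le> vectorspace.dim (GFp p) (G.vs T.im)"
    using vectorspace.subspace_dim[OF vsI sub' fdI] fdS' by simp
  also have "\<dots> \<le> vectorspace.dim (GFp p) (F.span_vs S)"
    using T.rank_nullity[OF fdS] by linarith
  finally show ?thesis
    by (simp add: fp_rank_def Let_def S_def S'_def F_def G_def)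
qed

section \<open>The simple random walk\<close>

text \<open>Expectation of \<open>f\<close> at the position of the simple symmetric walk after
  \<open>n\<close> steps from 0. Conditioning on one step shifts \<open>f\<close>, so the basic
  facts follow by induction with \<open>f\<close> arbitrary and without a probability space.\<close>

primrec walk_exp :: "nat \<Rightarrow> (int \<Rightarrow> real) \<Rightarrow> real" where
  "walk_exp 0 f = f 0"
| "walk_exp (Suc n) f = (walk_exp n (\<lambda>s. f (s + 1)) + walk_exp n (\<lambda>s. f (s - 1))) / 2"

lemma walk_exp_mono:
  assumes "\<And>s. f s \<le> g s"
  shows "walk_exp n f \<le> walk_exp n g"
  using assms
proof (induction n arbitrary: f g)
  case (Suc n)
  have "walk_exp n (\<lambda>s. f (s + 1)) \<le> walk_exp n (\<lambda>s. g (s + 1))"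
    "walk_exp n (\<lambda>s. f (s - 1)) \<le> walk_exp n (\<lambda>s. g (s - 1))"
    using Suc.prems by (auto intro!: Suc.IH)
  then show ?case by simp
qed simp

lemma walk_exp_const [simp]: "walk_exp n (\<lambda>_. c) = c"
  by (induction n) auto

lemma walk_exp_nonneg: "(\<And>s. 0 \<le> f s) \<Longrightarrow> 0 \<le> walk_exp n f"
  using walk_exp_mono[of "\<lambda>_. 0" f n] by simp

lemma walk_exp_add: "walk_exp n (\<lambda>s. f s + g s) = walk_exp n f + walk_exp n g"
  by (induction n arbitrary: f g) (simp_all add: add_divide_distrib)

lemma walk_exp_cmult: "walk_exp n (\<lambda>s. c * f s) = c * walk_exp n f"
  by (induction n arbitrary: f) (simp_all add: algebra_simps)

lemma walk_exp_diff: "walk_exp n (\<lambda>s. f s - g s) = walk_exp n f - walk_exp n g"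
  using walk_exp_add[of n f "\<lambda>s. (-1) * g s"] walk_exp_cmult[of n "-1" g] by simp

lemma walk_exp_sum: "finite A \<Longrightarrow> walk_exp n (\<lambda>s. \<Sum>a\<in>A. f a s) = (\<Sum>a\<in>A. walk_exp n (f a))"
  by (induction A rule: finite_induct) (simp_all add: walk_exp_add)

lemma walk_exp_uminus: "walk_exp n (\<lambda>s. f (- s)) = walk_exp n f"
proof (induction n arbitrary: f)
  case (Suc n)
  have "walk_exp n (\<lambda>s. f (- (s + 1))) = walk_exp n (\<lambda>s. f (s - 1))"
    using Suc[of "\<lambda>s. f (s - 1)"] by simp
  moreover have "walk_exp n (\<lambda>s. f (- (s - 1))) = walk_exp n (\<lambda>s. f (s + 1))"
    using Suc[of "\<lambda>s. f (s + 1)"] by (simp add: algebra_simps)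
  ultimately show ?case by simp
qed simp

section \<open>Second and fourth moments of the walk\<close>

lemma walk_exp_square: "walk_exp n (\<lambda>s. (real_of_int s)\<^sup>2) = n"
proof (induction n)
  case (Suc n)
  have "walk_exp (Suc n) (\<lambda>s. (real_of_int s)\<^sup>2)
      = walk_exp n (\<lambda>s. ((real_of_int s + 1)\<^sup>2 + (real_of_int s - 1)\<^sup>2) / 2)"
    using walk_exp_cmult[of n "1/2" "\<lambda>s. (real_of_int s + 1)\<^sup>2 + (real_of_int s - 1)\<^sup>2"]
    by (simp add: walk_exp_add)
  also have "\<dots> = walk_exp n (\<lambda>s. (real_of_int s)\<^sup>2 + 1)"
    by (simp add: power2_eq_square algebra_simps add_divide_distrib)
  finally show ?case using Suc by (simp add: walk_exp_add)
qed simp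

text \<open>Averaging \<open>(s + 1) ^ 4\<close> and \<open>(s - 1) ^ 4\<close> gives
  \<open>s ^ 4 + 6 * s ^ 2 + 1\<close>, so by the second moment each step adds
  \<open>6 * n + 1\<close>.\<close>

lemma walk_exp_power4: "walk_exp n (\<lambda>s. (real_of_int s) ^ 4) = 3 * real n ^ 2 - 2 * n"
proof (induction n)
  case (Suc n)
  have "walk_exp (Suc n) (\<lambda>s. (real_of_int s) ^ 4)
      = walk_exp n (\<lambda>s. ((real_of_int s + 1) ^ 4 + (real_of_int s - 1) ^ 4) / 2)"
    using walk_exp_cmult[of n "1/2" "\<lambda>s. (real_of_int s + 1) ^ 4 + (real_of_int s - 1) ^ 4"]
    by (simp add: walk_exp_add)
  also have "(\<lambda>s. ((real_of_int s + 1) ^ 4 + (real_of_int s - 1) ^ 4) / 2)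
      = (\<lambda>s. (real_of_int s) ^ 4 + (6 * (real_of_int s)\<^sup>2 + 1))"
    by (simp add: eval_nat_numeral algebra_simps add_divide_distrib)
  also have "walk_exp n (\<lambda>s. (real_of_int s) ^ 4 + (6 * (real_of_int s)\<^sup>2 + 1))
      = 3 * real n ^ 2 - 2 * n + (6 * n + 1)"
    by (simp only: walk_exp_add walk_exp_cmult walk_exp_square walk_exp_const Suc)
  finally show ?case by (simp only: of_nat_Suc) (simp add: power2_eq_square algebra_simps)
qed simp

section \<open>Point probabilities: parity, symmetry and unimodality\<close>

definition walk_prob :: "nat \<Rightarrow> int \<Rightarrow> real" where
  "walk_prob n t = walk_exp n (\<lambda>s. of_bool (s = t))"

lemma walk_prob_0: "walk_prob 0 t = of_bool (t = 0)"
  by (auto simp: walk_prob_def)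

lemma walk_prob_Suc: "walk_prob (Suc n) t = (walk_prob n (t - 1) + walk_prob n (t + 1)) / 2"
proof -
  have "(\<lambda>s. of_bool (s + 1 = t)) = (\<lambda>s. of_bool (s = t - 1) :: real)"
       "(\<lambda>s. of_bool (s - 1 = t)) = (\<lambda>s. of_bool (s = t + 1) :: real)"
    by (auto simp: fun_eq_iff)
  then show ?thesis by (simp add: walk_prob_def)
qed

lemma walk_prob_nonneg: "0 \<le> walk_prob n t"
  unfolding walk_prob_def by (rule walk_exp_nonneg) simp

lemma walk_prob_uminus: "walk_prob n (- t) = walk_prob n t"
proof -
  have "(\<lambda>s. of_bool (s = - t)) = (\<lambda>s. of_bool (- s = t) :: real)" by (auto simp: fun_eq_iff)
  then show ?thesis using walk_exp_uminus[of n "\<lambda>s. of_bool (s = t)"] by (simp add: walk_prob_def)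
qed

lemma walk_prob_abs: "walk_prob n \<bar>t\<bar> = walk_prob n t"
  using walk_prob_uminus[of n t] by (simp add: abs_if)

lemma walk_prob_parity: "odd (t + int n) \<Longrightarrow> walk_prob n t = 0"
  by (induction n arbitrary: t) (auto simp: walk_prob_0 walk_prob_Suc)

text \<open>Unimodality along one parity class. The range includes \<open>t = -1\<close>, where
  symmetry gives equality, because the induction step at \<open>t = 0\<close> refers to that
  point.\<close>

lemma walk_prob_step: "t \<ge> -1 \<Longrightarrow> walk_prob n (t + 2) \<le> walk_prob n t"
proof (induction n arbitrary: t)
  case 0
  then show ?case by (auto simp: walk_prob_0)
next
  case (Suc n)
  show ?case
  proof (cases "t = -1")
    case True
    then show ?thesis using walk_prob_uminus[of "Suc n" 1] by simp
  next
    case False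
    then have "walk_prob n ((t - 1) + 2) \<le> walk_prob n (t - 1)"
      by (intro Suc.IH) (use Suc.prems in simp)
    moreover have "walk_prob n ((t + 1) + 2) \<le> walk_prob n (t + 1)"
      by (intro Suc.IH) (use Suc.prems in simp)
    ultimately show ?thesis by (simp add: walk_prob_Suc algebra_simps)
  qed
qed

lemma walk_prob_add_even_le: "0 \<le> t \<Longrightarrow> walk_prob n (t + 2 * int d) \<le> walk_prob n t"
proof (induction d)
  case (Suc d)
  have "walk_prob n (t + 2 * int d + 2) \<le> walk_prob n (t + 2 * int d)"
    by (rule walk_prob_step) (use Suc.prems in simp)
  then show ?case using Suc by (simp add: algebra_simps)
qed simp

lemma walk_prob_antimono:
  assumes "\<bar>s\<bar> \<le> \<bar>t\<bar>" "even (s + t)"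
  shows "walk_prob n t \<le> walk_prob n s"
proof -
  from assms have "even (\<bar>t\<bar> - \<bar>s\<bar>)" by (auto simp: abs_if)
  then obtain e where e: "\<bar>t\<bar> - \<bar>s\<bar> = 2 * e" by blast
  then have "\<bar>t\<bar> = \<bar>s\<bar> + 2 * int (nat e)" using assms(1) by simp
  then have "walk_prob n \<bar>t\<bar> \<le> walk_prob n \<bar>s\<bar>"
    using walk_prob_add_even_le[of "\<bar>s\<bar>" n "nat e"] by (metis abs_ge_zero)
  then show ?thesis by (simp add: walk_prob_abs)
qed

section \<open>Mass and cardinality of symmetric windows\<close>

text \<open>The walk of \<open>n\<close> steps only visits points with the parity of \<open>n\<close>.\<close>

definition parity_window :: "nat \<Rightarrow> real \<Rightarrow> int set" where
  "parity_window n a = {t. \<bar>real_of_int t\<bar> \<le> a \<and> even (t + int n)}"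

lemma finite_abs_le: "finite {t::int. \<bar>real_of_int t\<bar> \<le> a}"
proof (rule finite_subset)
  show "{t::int. \<bar>real_of_int t\<bar> \<le> a} \<subseteq> {-\<lfloor>a\<rfloor>..\<lfloor>a\<rfloor>}"
    by (auto simp: le_floor_iff abs_le_iff) linarith
qed simp

lemma finite_parity_window: "finite (parity_window n a)"
  unfolding parity_window_def by (rule finite_subset[OF _ finite_abs_le[of a]]) auto

lemma walk_exp_window:
  "walk_exp n (\<lambda>s. of_bool (\<bar>real_of_int s\<bar> \<le> a)) = sum (walk_prob n) (parity_window n a)"
proof -
  have "walk_exp n (\<lambda>s. of_bool (\<bar>real_of_int s\<bar> \<le> a))
      = walk_exp n (\<lambda>s. \<Sum>t | \<bar>real_of_int t\<bar> \<le> a. of_bool (s = t))"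
    by (intro arg_cong[where f = "walk_exp n"] ext)
      (use finite_abs_le[of a] in \<open>simp add: of_bool_def sum.delta\<close>)
  also have "\<dots> = (\<Sum>t | \<bar>real_of_int t\<bar> \<le> a. walk_prob n t)"
    unfolding walk_prob_def by (rule walk_exp_sum[OF finite_abs_le])
  also have "\<dots> = sum (walk_prob n) (parity_window n a)"
    by (rule sum.mono_neutral_right[OF finite_abs_le])
      (auto simp: parity_window_def walk_prob_parity)
  finally show ?thesis .
qed

lemma card_parity_window_ge:
  "real s \<le> card (parity_window n (real s))"
proof -
  \<comment> \<open>A progression of difference two starting at \<open>- s\<close>, shifted by one
    when \<open>n\<close> and \<open>s\<close> differ in parity. Its \<open>s\<close> terms stay
    between \<open>- s\<close> and \<open>s - 1\<close>.\<close>
  have "(\<lambda>i. 2 * int i - int s + (int n + int s) mod 2) ` {..<s} \<subseteq> parity_window n (real s)"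
  proof
    fix t assume "t \<in> (\<lambda>i. 2 * int i - int s + (int n + int s) mod 2) ` {..<s}"
    then obtain i where i: "i < s" "t = 2 * int i - int s + (int n + int s) mod 2" by auto
    have "\<bar>t\<bar> \<le> int s" using i by linarith
    moreover have "even (t + int n)" unfolding i by presburger
    ultimately show "t \<in> parity_window n (real s)" by (auto simp: parity_window_def)
  qed
  then have "card ((\<lambda>i. 2 * int i - int s + (int n + int s) mod 2) ` {..<s}) \<le> card (parity_window n (real s))"
    by (rule card_mono[OF finite_parity_window])
  moreover have "card ((\<lambda>i. 2 * int i - int s + (int n + int s) mod 2) ` {..<s}) = s"
    by (subst card_image) (auto simp: inj_on_def)
  ultimately show ?thesis by simp
qed

lemma card_parity_window_le:
  assumes "0 \<le> a"
  shows "real (card (parity_window n a)) \<le> a + 1"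
proof -
  define m where "m = nat \<lfloor>a\<rfloor>"
  have m: "real m \<le> a" "a < real m + 1" using assms unfolding m_def by linarith+
  \<comment> \<open>The same progression with \<open>m\<close>, the floor of \<open>a\<close>, in
    place of \<open>s\<close> and one term more, which gives the bound \<open>m + 1\<close>.\<close>
  have "parity_window n a \<subseteq> (\<lambda>i. 2 * int i - int m + (int n + int m) mod 2) ` {..m}"
  proof
    fix t assume "t \<in> parity_window n a"
    then have t: "\<bar>real_of_int t\<bar> \<le> a" "even (t + int n)" by (auto simp: parity_window_def)
    have "\<bar>t\<bar> \<le> int m" using t m by linarith
    moreover have "(t + int m) mod 2 = (int n + int m) mod 2" using t(2) by presburger
    moreover define i where "i = nat ((t + int m) div 2)"
    ultimately have "i \<le> m" "t = 2 * int i - int m + (int n + int m) mod 2"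
      using div_mult_mod_eq[of "t + int m" 2] by linarith+
    then show "t \<in> (\<lambda>i. 2 * int i - int m + (int n + int m) mod 2) ` {..m}" by auto
  qed
  then have "card (parity_window n a) \<le> card ((\<lambda>i. 2 * int i - int m + (int n + int m) mod 2) ` {..m})"
    by (rule card_mono[rotated]) simp
  also have "\<dots> \<le> card {..m}" by (rule card_image_le) simp
  finally show ?thesis using m by simp
qed

text \<open>By Chebyshev the window \<open>J\<close> of radius \<open>2 * sqrt n\<close> has mass at
  least 3/4. A smaller window \<open>I\<close> has at least the average mass per point of
  \<open>J\<close>, by unimodality. With at least \<open>s\<close> points in \<open>I\<close> and at
  most \<open>3 * sqrt n\<close> in \<open>J\<close>, this leaves
  \<open>s / (4 * sqrt n)\<close>.\<close>

lemma walk_exp_window_ge: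
  assumes "0 < n"
  shows "min (real s / (4 * sqrt n)) (3 / 4) \<le> walk_exp n (\<lambda>t. of_bool (\<bar>t\<bar> \<le> int s))"
proof -
  define I where "I = parity_window n s"
  define J where "J = parity_window n (2 * sqrt n)"
  define w where "w = walk_prob n"
  have fin: "finite I" "finite J" by (auto simp: I_def J_def finite_parity_window)
  have eq: "walk_exp n (\<lambda>t. of_bool (\<bar>t\<bar> \<le> int s)) = sum w I"
  proof -
    have "(\<lambda>t. of_bool (\<bar>t\<bar> \<le> int s)) = (\<lambda>t. of_bool (\<bar>real_of_int t\<bar> \<le> real s) :: real)"
      by (intro ext arg_cong[where f = of_bool]) linarith
    then show ?thesis by (simp add: walk_exp_window I_def w_def)
  qed
  have J34: "3 / 4 \<le> sum w J"
  proof -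
    \<comment> \<open>Chebyshev pointwise: outside the window the left side is negative, inside it
      is at most 1.\<close>
    have "1 - (real_of_int t)\<^sup>2 / (4 * n) \<le> of_bool (\<bar>real_of_int t\<bar> \<le> 2 * sqrt n)" for t
    proof (cases "\<bar>real_of_int t\<bar> \<le> 2 * sqrt n")
      case False
      then have "(2 * sqrt n)\<^sup>2 \<le> \<bar>real_of_int t\<bar>\<^sup>2" by (intro power_mono) auto
      then show ?thesis using False assms by (simp add: power_mult_distrib field_simps)
    qed simp
    then have "walk_exp n (\<lambda>t. 1 - (real_of_int t)\<^sup>2 / (4 * n)) \<le> sum w J"
      unfolding J_def w_def walk_exp_window[symmetric] by (rule walk_exp_mono)
    also have "walk_exp n (\<lambda>t. 1 - (real_of_int t)\<^sup>2 / (4 * n)) = 3 / 4"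
      using assms walk_exp_cmult[of n "1 / (4 * n)" "\<lambda>t. (real_of_int t)\<^sup>2"]
      by (simp add: walk_exp_diff walk_exp_square)
    finally show ?thesis .
  qed
  show ?thesis
  proof (cases "2 * sqrt n \<le> real s")
    case True
    then have "J \<subseteq> I" by (auto simp: I_def J_def parity_window_def)
    then have "sum w J \<le> sum w I"
      by (intro sum_mono2) (auto simp: fin w_def walk_prob_nonneg)
    then show ?thesis using J34 eq by simp
  next
    case False
    then have sub: "I \<subseteq> J" by (auto simp: I_def J_def parity_window_def)
    \<comment> \<open>Each point of \<open>J - I\<close> is farther from 0 than each point of
      \<open>I\<close> and has the same parity. Summing over all pairs compares the average
      masses.\<close>
    have "(\<Sum>j\<in>J - I. \<Sum>i\<in>I. w j) \<le> (\<Sum>j\<in>J - I. \<Sum>i\<in>I. w i)"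
      by (intro sum_mono) (auto simp: w_def I_def J_def parity_window_def intro!: walk_prob_antimono)
    then have "real (card I) * sum w (J - I) \<le> real (card (J - I)) * sum w I"
      by (simp add: sum_distrib_left)
    moreover have "sum w J = sum w I + sum w (J - I)"
      using sub fin by (simp add: sum.subset_diff)
    moreover have "real (card J) = real (card I) + real (card (J - I))"
      using sub fin by (simp add: card_Diff_subset card_mono)
    ultimately have main: "real (card I) * sum w J \<le> real (card J) * sum w I"
      by (simp add: algebra_simps)
    have w0: "0 \<le> sum w I" by (intro sum_nonneg) (simp add: w_def walk_prob_nonneg)
    have "real s * (3 / 4) \<le> real (card I) * sum w J"
      using card_parity_window_ge[of s n] J34 by (intro mult_mono) (auto simp: I_def)
    also note main
    also have "real (card J) * sum w I \<le> (3 * sqrt n) * sum w I"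
    proof (rule mult_right_mono[OF _ w0])
      have "real (card J) \<le> 2 * sqrt n + 1" unfolding J_def by (rule card_parity_window_le) simp
      also have "\<dots> \<le> 3 * sqrt n" using assms by simp
      finally show "real (card J) \<le> 3 * sqrt n" .
    qed
    finally have "real s / (4 * sqrt n) \<le> sum w I"
      using assms by (simp add: field_simps)
    then show ?thesis using eq by simp
  qed
qed

section \<open>Majorities of nested blocks of steps\<close>

definition maj_sgn :: "int \<Rightarrow> real" where
  "maj_sgn s = (if 0 \<le> s then 1 else -1)"

text \<open>Average over \<open>t\<close> and \<open>- t\<close>: the two signs are both 1 if
  \<open>\<bar>t\<bar> \<le> s\<close> and cancel otherwise.\<close>

lemma walk_exp_maj_sgn_nonneg:
  assumes "0 \<le> s"
  shows "walk_exp m (\<lambda>t. maj_sgn (s + t)) = walk_exp m (\<lambda>t. of_bool (\<bar>t\<bar> \<le> s))"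
proof -
  have "2 * walk_exp m (\<lambda>t. maj_sgn (s + t))
      = walk_exp m (\<lambda>t. maj_sgn (s + t)) + walk_exp m (\<lambda>t. maj_sgn (s + - t))"
    using walk_exp_uminus[of m "\<lambda>t. maj_sgn (s + t)"] by simp
  also have "\<dots> = walk_exp m (\<lambda>t. 2 * of_bool (\<bar>t\<bar> \<le> s))"
    unfolding walk_exp_add[symmetric] using assms
    by (intro arg_cong[where f = "walk_exp m"] ext) (auto simp: maj_sgn_def)
  finally show ?thesis by (simp add: walk_exp_cmult)
qed

text \<open>At most one of \<open>s + t\<close> and \<open>s - t\<close> is nonnegative, since they
  add up to \<open>2 * s < 0\<close>.\<close>

lemma walk_exp_maj_sgn_neg:
  assumes "s < 0"
  shows "walk_exp m (\<lambda>t. maj_sgn (s + t)) \<le> 0"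
proof -
  have "2 * walk_exp m (\<lambda>t. maj_sgn (s + t))
      = walk_exp m (\<lambda>t. maj_sgn (s + t)) + walk_exp m (\<lambda>t. maj_sgn (s + - t))"
    using walk_exp_uminus[of m "\<lambda>t. maj_sgn (s + t)"] by simp
  also have "\<dots> \<le> walk_exp m (\<lambda>_. 0)"
    unfolding walk_exp_add[symmetric] using assms
    by (intro walk_exp_mono) (auto simp: maj_sgn_def)
  finally show ?thesis by simp
qed

text \<open>This sign agreement allows negative partial sums to be discarded, and pointwise lower
  bounds to be multiplied by the product.\<close>

lemma maj_sgn_walk_exp_nonneg: "0 \<le> maj_sgn s * walk_exp m (\<lambda>t. maj_sgn (s + t))"
proof (cases "0 \<le> s")
  case True
  then show ?thesis
    by (simp add: walk_exp_maj_sgn_nonneg maj_sgn_def[of s] walk_exp_nonneg)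
next
  case False
  then show ?thesis
    using walk_exp_maj_sgn_neg[of s m] by (simp add: maj_sgn_def[of s])
qed

text \<open>
  Truncation at \<open>3\<close> matches the bound \<open>3/4\<close> in \<open>walk_exp_window_ge\<close>; a polynomial minorant makes the
  expectation computable from moments.
\<close>

lemma min_ge_quartic:
  fixes u :: real
  assumes "0 \<le> u"
  shows "u\<^sup>2 - u ^ 4 / 6 \<le> min u 3"
proof -
  have "u\<^sup>2 - u ^ 4 / 6 = 3 / 2 - (u\<^sup>2 - 3)\<^sup>2 / 6"
    by (simp add: power2_eq_square power4_eq_xxxx field_simps)
  then have "u\<^sup>2 - u ^ 4 / 6 \<le> 3" using zero_le_power2[of "u\<^sup>2 - 3"] by linarith
  moreover have "u\<^sup>2 - u ^ 4 / 6 \<le> u"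
  proof -
    have "0 \<le> 6 - 6 * u + u ^ 3"
    proof (cases "u \<le> 1")
      case True
      then show ?thesis using assms zero_le_power[of u 3] by linarith
    next
      case False
      \<comment> \<open>The double root 3/2 is a rational point near the minimiser
        \<open>sqrt 2\<close> of the target cubic. The target exceeds this cubic by
        \<open>3 / 4 * (u - 1)\<close>, which is positive here.\<close>
      have "0 \<le> (u - 3 / 2)\<^sup>2 * (u + 3)" using assms by simp
      also have "\<dots> = u ^ 3 - 27 / 4 * u + 27 / 4"
        by (simp add: power2_eq_square power3_eq_cube field_simps)
      finally show ?thesis using False by linarith
    qed
    then have "0 \<le> u * (6 - 6 * u + u ^ 3)" using assms by simp
    then show ?thesis by (simp add: power2_eq_square power3_eq_cube power4_eq_xxxx field_simps)
  qed
  ultimately show ?thesis by simp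
qed

text \<open>With \<open>u = s / sqrt k\<close>, the window bound is at least
  \<open>c * min u 3\<close> for \<open>s \<ge> 0\<close>, hence at least \<open>c\<close> times the
  quartic in \<open>u\<close>; negative \<open>s\<close> are dropped. The moments give the quartic
  mean at least 1/2, half of it from \<open>s \<ge> 0\<close>, so the result is
  \<open>c / 4\<close>.\<close>

lemma walk_exp_maj_correlation:
  assumes "0 < k" "k < n"
  shows "sqrt k / (16 * sqrt n)
    \<le> walk_exp k (\<lambda>s. maj_sgn s * walk_exp (n - k) (\<lambda>t. maj_sgn (s + t)))"
proof -
  define g where "g s = (real_of_int s)\<^sup>2 / k - (real_of_int s) ^ 4 / (6 * (real k)\<^sup>2)" for s
  define c where "c = sqrt k / (4 * sqrt n)"
  have c: "0 < c" "c * 3 \<le> 3 / 4" "c \<le> sqrt k / (4 * sqrt (n - k))"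
    using assms by (auto simp: c_def field_simps)
  have "c * (of_bool (0 \<le> s) * g s) \<le> maj_sgn s * walk_exp (n - k) (\<lambda>t. maj_sgn (s + t))" for s
  proof (cases "0 \<le> s")
    case True
    define u where "u = real_of_int s / sqrt k"
    have u: "0 \<le> u" "real_of_int s = sqrt k * u" using True assms by (auto simp: u_def)
    have "g s = u\<^sup>2 - u ^ 4 / 6"
    proof -
      have "sqrt k ^ 4 = (real k)\<^sup>2"
        by (metis mult_2 numeral_Bit0 of_nat_0_le_iff power_mult real_sqrt_pow2)
      then show ?thesis using assms by (simp add: g_def u power_mult_distrib)
    qed
    then have "c * g s \<le> c * min u 3"
      using min_ge_quartic[OF u(1)] c by simp
    also have "\<dots> \<le> min (c * u) (3 / 4)" using c by (simp add: min_mult_distrib_left)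
    also have "\<dots> \<le> min (real (nat s) / (4 * sqrt (n - k))) (3 / 4)"
    proof -
      have "c * u \<le> sqrt k / (4 * sqrt (n - k)) * u" using c u by (intro mult_right_mono)
      also have "\<dots> = real (nat s) / (4 * sqrt (n - k))" using u True by simp
      finally show ?thesis by (rule min.mono) simp
    qed
    also have "\<dots> \<le> walk_exp (n - k) (\<lambda>t. of_bool (\<bar>t\<bar> \<le> int (nat s)))"
      by (rule walk_exp_window_ge) (use assms in simp)
    also have "\<dots> = maj_sgn s * walk_exp (n - k) (\<lambda>t. maj_sgn (s + t))"
      using True by (simp add: walk_exp_maj_sgn_nonneg maj_sgn_def[of s])
    finally show ?thesis using True by simp
  next
    case False
    then show ?thesis by (simp add: maj_sgn_walk_exp_nonneg)
  qed
  then have "walk_exp k (\<lambda>s. c * (of_bool (0 \<le> s) * g s))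
      \<le> walk_exp k (\<lambda>s. maj_sgn s * walk_exp (n - k) (\<lambda>t. maj_sgn (s + t)))"
    by (rule walk_exp_mono)
  moreover have "2 * walk_exp k (\<lambda>s. of_bool (0 \<le> s) * g s) \<ge> 1 / 2"
  proof -
    \<comment> \<open>\<open>g\<close> is even and vanishes at 0, so the two half lines together
      give exactly the mean of \<open>g\<close>.\<close>
    have "2 * walk_exp k (\<lambda>s. of_bool (0 \<le> s) * g s)
      = walk_exp k (\<lambda>s. of_bool (0 \<le> s) * g s) + walk_exp k (\<lambda>s. of_bool (0 \<le> - s) * g (- s))"
      using walk_exp_uminus[of k "\<lambda>s. of_bool (0 \<le> s) * g s"] by simp
    also have "\<dots> = walk_exp k g"
      unfolding walk_exp_add[symmetric]
      by (intro arg_cong[where f = "walk_exp k"] ext) (auto simp: g_def)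
    also have "\<dots> = walk_exp k (\<lambda>s. (1 / k) * (real_of_int s)\<^sup>2 - (1 / (6 * (real k)\<^sup>2)) * (real_of_int s) ^ 4)"
      by (intro arg_cong[where f = "walk_exp k"] ext) (simp add: g_def)
    also have "\<dots> = (1 / k) * k - (1 / (6 * (real k)\<^sup>2)) * (3 * (real k)\<^sup>2 - 2 * k)"
      by (simp only: walk_exp_diff walk_exp_cmult walk_exp_square walk_exp_power4)
    \<comment> \<open>The value is \<open>1 / 2 + 1 / (3 * k)\<close>.\<close>
    also have "\<dots> \<ge> 1 / 2"
      using assms by (simp add: field_simps power2_eq_square)
    finally show ?thesis .
  qed
  then have "c * (1 / 4) \<le> c * walk_exp k (\<lambda>s. of_bool (0 \<le> s) * g s)"
    using c by (intro mult_left_mono) auto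
  ultimately have "c * (1 / 4) \<le> walk_exp k (\<lambda>s. maj_sgn s * walk_exp (n - k) (\<lambda>t. maj_sgn (s + t)))"
    unfolding walk_exp_cmult by linarith
  then show ?thesis by (simp add: c_def)
qed

section \<open>Majority powers of a balanced matrix\<close>

lemma tuples_0: "tuples q 0 = {[]}"
  by (auto simp: tuples_def)

lemma tuples_Suc: "tuples q (Suc n) = (\<lambda>(i, x). i # x) ` ({..<q} \<times> tuples q n)"
  by (auto simp: tuples_def length_Suc_conv image_iff)

lemma finite_tuples: "finite (tuples q n)"
  by (induction n) (auto simp: tuples_0 tuples_Suc)

lemma sum_tuples_Suc: "(\<Sum>x\<in>tuples q (Suc n). g x) = (\<Sum>i<q. \<Sum>x\<in>tuples q n. g (i # x))"
  unfolding tuples_Suc sum.cartesian_product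
  by (subst sum.reindex) (auto simp: inj_on_def case_prod_unfold)

lemma sum_tuples_add:
  "(\<Sum>x\<in>tuples q (m + n). g x) = (\<Sum>u\<in>tuples q m. \<Sum>v\<in>tuples q n. g (u @ v))"
  by (induction m arbitrary: g) (simp_all add: tuples_0 sum_tuples_Suc)

lemma card_tuples: "card (tuples q n) = q ^ n"
  unfolding tuples_def
  using card_lists_length_eq[of "{..<q}" n] by (simp add: conj_commute)

text \<open>On signs, \<open>f\<close> is affine in the indicator of 1. Balance of \<open>A\<close>
  makes an entry at uniformly random indices a fair sign, and it enters the argument only through
  this lemma.\<close>

lemma sum_balanced:
  fixes f :: "int \<Rightarrow> real"
  assumes A: "\<forall>i<q. \<forall>j<q. A i j \<in> {-1, 1 :: int}"
    and half: "2 * card {(i, j). i < q \<and> j < q \<and> A i j = 1} = q ^ 2"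
  shows "(\<Sum>i<q. \<Sum>j<q. f (A i j)) = (real q)\<^sup>2 * ((f 1 + f (-1)) / 2)"
proof -
  have "(\<Sum>i<q. \<Sum>j<q. f (A i j))
      = (\<Sum>(i, j)\<in>{..<q} \<times> {..<q}. f (-1) + (f 1 - f (-1)) * of_bool (A i j = 1))"
    unfolding sum.cartesian_product
    by (intro sum.cong refl) (use A in force)
  also have "\<dots> = (real q)\<^sup>2 * f (-1)
      + (f 1 - f (-1)) * (\<Sum>z\<in>{..<q} \<times> {..<q}. of_bool (A (fst z) (snd z) = 1))"
    by (simp add: case_prod_unfold sum.distrib sum_distrib_left power2_eq_square)
  also have "(\<Sum>z\<in>{..<q} \<times> {..<q}. of_bool (A (fst z) (snd z) = 1))
      = real (card {(i, j). i < q \<and> j < q \<and> A i j = 1})"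
    by (subst sum_of_bool_eq) (auto intro!: arg_cong[where f = card])
  also have "\<dots> = (real q)\<^sup>2 / 2"
    using half by (metis (mono_tags, lifting) nonzero_mult_div_cancel_left of_nat_mult
        of_nat_numeral of_nat_power zero_neq_numeral)
  finally show ?thesis by (simp add: field_simps)
qed

text \<open>The sum inside \<open>maj_power\<close>, written with \<open>map2\<close> so that it
  splits over Cons and append.\<close>

definition pair_sum :: "(nat \<Rightarrow> nat \<Rightarrow> int) \<Rightarrow> nat list \<Rightarrow> nat list \<Rightarrow> int" where
  "pair_sum A x y = sum_list (map2 A x y)"

lemma maj_power_eq:
  assumes "x \<in> tuples q n" "y \<in> tuples q n"
  shows "real_of_int (maj_power n A x y) = maj_sgn (pair_sum A x y)"
proof -
  have "map (\<lambda>i. A (x ! i) (y ! i)) [0..<n] = map2 A x y"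
    using assms by (intro nth_equalityI) (auto simp: tuples_def)
  then show ?thesis by (simp add: maj_power_def maj_def maj_sgn_def pair_sum_def)
qed

lemma pair_sum_append:
  "length u = length u' \<Longrightarrow> pair_sum A (u @ v) (u' @ v') = pair_sum A u u' + pair_sum A v v'"
  by (simp add: pair_sum_def)

text \<open>For uniformly random tuples the entries of \<open>A\<close> are independent fair signs,
  so their sum is distributed as the walk; the factor counts the pairs. The induction peels off the
  first row and column index together.\<close>

lemma sum_tuples_pair_sum:
  fixes f :: "int \<Rightarrow> real"
  assumes A: "\<forall>i<q. \<forall>j<q. A i j \<in> {-1, 1 :: int}"
    and half: "2 * card {(i, j). i < q \<and> j < q \<and> A i j = 1} = q ^ 2"
  shows "(\<Sum>x\<in>tuples q n. \<Sum>y\<in>tuples q n. f (pair_sum A x y)) = real q ^ (2 * n) * walk_exp n f"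
proof (induction n arbitrary: f)
  case 0
  then show ?case by (simp add: tuples_0 pair_sum_def)
next
  case (Suc n)
  let ?T = "tuples q n"
  have "(\<Sum>x\<in>tuples q (Suc n). \<Sum>y\<in>tuples q (Suc n). f (pair_sum A x y))
      = (\<Sum>i<q. \<Sum>x\<in>?T. \<Sum>j<q. \<Sum>y\<in>?T. f (A i j + pair_sum A x y))"
    by (simp add: sum_tuples_Suc pair_sum_def)
  also have "\<dots> = (\<Sum>i<q. \<Sum>j<q. \<Sum>x\<in>?T. \<Sum>y\<in>?T. f (A i j + pair_sum A x y))"
    by (intro sum.cong refl sum.swap)
  also have "\<dots> = (\<Sum>i<q. \<Sum>j<q. real q ^ (2 * n) * walk_exp n (\<lambda>s. f (A i j + s)))"
    by (simp add: Suc[of "\<lambda>s. f (_ + s)"])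
  also have "\<dots> = (real q)\<^sup>2 * ((real q ^ (2 * n) * walk_exp n (\<lambda>s. f (1 + s))
      + real q ^ (2 * n) * walk_exp n (\<lambda>s. f (-1 + s))) / 2)"
    by (rule sum_balanced[OF A half, of "\<lambda>a. real q ^ (2 * n) * walk_exp n (\<lambda>s. f (a + s))"])
  also have "\<dots> = real q ^ (2 * Suc n) * walk_exp (Suc n) f"
    by (simp add: algebra_simps power2_eq_square)
  finally show ?case .
qed

text \<open>Here \<open>e\<close> stands for the expected sign of the random matrix and
  \<open>\<epsilon>\<close> for \<open>1 - 2 * \<delta>\<close>. Splitting tuples after
  \<open>k\<close> entries and summing out the suffixes turns the right side into a sum over
  prefixes of \<open>e\<close> times the conditional expected majority.\<close>

lemma maj_power_correlation_ge:
  fixes e :: "nat list \<Rightarrow> nat list \<Rightarrow> real"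
  assumes A: "\<forall>i<q. \<forall>j<q. A i j \<in> {-1, 1 :: int}"
    and half: "2 * card {(i, j). i < q \<and> j < q \<and> A i j = 1} = q ^ 2"
    and kn: "0 < k" "k < n" and \<epsilon>: "0 \<le> \<epsilon>"
    and e: "\<And>u v. u \<in> tuples q k \<Longrightarrow> v \<in> tuples q k \<Longrightarrow> \<epsilon> \<le> real_of_int (maj_power k A u v) * e u v"
  shows "real q ^ (2 * n) * (\<epsilon> * (sqrt k / (16 * sqrt n)))
    \<le> (\<Sum>x\<in>tuples q n. \<Sum>y\<in>tuples q n. real_of_int (maj_power n A x y) * e (take k x) (take k y))"
proof -
  define m where "m = n - k"
  have n: "n = k + m" using kn by (simp add: m_def)
  let ?h = "\<lambda>s. walk_exp m (\<lambda>t. maj_sgn (s + t))"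
  let ?T = "tuples q"
  have len: "length u = l" if "u \<in> ?T l" for u l using that by (simp add: tuples_def)
  have "real q ^ (2 * n) * (\<epsilon> * (sqrt k / (16 * sqrt n)))
      \<le> real q ^ (2 * n) * (\<epsilon> * walk_exp k (\<lambda>s. maj_sgn s * ?h s))"
    using walk_exp_maj_correlation[OF kn] \<epsilon> by (intro mult_left_mono) (auto simp: m_def)
  also have "\<dots> = real q ^ (2 * m) * (\<epsilon> * (\<Sum>u\<in>?T k. \<Sum>v\<in>?T k.
      maj_sgn (pair_sum A u v) * ?h (pair_sum A u v)))"
    unfolding sum_tuples_pair_sum[OF A half, of "\<lambda>s. maj_sgn s * ?h s" k]
    by (simp add: n power_add distrib_left)
  also have "\<dots> = (\<Sum>u\<in>?T k. \<Sum>v\<in>?T k.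
      real q ^ (2 * m) * (\<epsilon> * (maj_sgn (pair_sum A u v) * ?h (pair_sum A u v))))"
    by (simp add: sum_distrib_left)
  also have "\<dots> \<le> (\<Sum>u\<in>?T k. \<Sum>v\<in>?T k.
      real q ^ (2 * m) * (e u v * ?h (pair_sum A u v)))"
  proof (intro sum_mono mult_left_mono)
    fix u v assume uv: "u \<in> ?T k" "v \<in> ?T k"
    let ?s = "maj_sgn (pair_sum A u v)"
    \<comment> \<open>The hypothesis on \<open>e\<close> is multiplied by a nonnegative quantity;
      afterwards the two factors \<open>?s\<close> cancel.\<close>
    have "\<epsilon> * (?s * ?h (pair_sum A u v)) \<le> (?s * e u v) * (?s * ?h (pair_sum A u v))"
      using e[OF uv] by (intro mult_right_mono maj_sgn_walk_exp_nonneg) (simp add: maj_power_eq[OF uv])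
    also have "\<dots> = e u v * ?h (pair_sum A u v)" by (simp add: maj_sgn_def[of "pair_sum A u v"])
    finally show "\<epsilon> * (?s * ?h (pair_sum A u v)) \<le> e u v * ?h (pair_sum A u v)" .
  qed simp
  also have "\<dots> = (\<Sum>u\<in>?T k. \<Sum>v\<in>?T k. \<Sum>u'\<in>?T m. \<Sum>v'\<in>?T m.
      e u v * maj_sgn (pair_sum A u v + pair_sum A u' v'))"
    by (simp add: sum_tuples_pair_sum[OF A half, of "\<lambda>t. maj_sgn (_ + t)"] sum_distrib_left[symmetric] algebra_simps)
  also have "\<dots> = (\<Sum>u\<in>?T k. \<Sum>u'\<in>?T m. \<Sum>v\<in>?T k. \<Sum>v'\<in>?T m.
      e u v * maj_sgn (pair_sum A u v + pair_sum A u' v'))"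
    by (intro sum.cong refl sum.swap)
  also have "\<dots> = (\<Sum>u\<in>?T k. \<Sum>u'\<in>?T m. \<Sum>v\<in>?T k. \<Sum>v'\<in>?T m.
      maj_sgn (pair_sum A (u @ u') (v @ v')) * e (take k (u @ u')) (take k (v @ v')))"
    by (intro sum.cong refl) (simp add: pair_sum_append len)
  also have "\<dots> = (\<Sum>x\<in>?T n. \<Sum>y\<in>?T n. maj_sgn (pair_sum A x y) * e (take k x) (take k y))"
    unfolding n by (simp only: sum_tuples_add)
  also have "\<dots> = (\<Sum>x\<in>?T n. \<Sum>y\<in>?T n. real_of_int (maj_power n A x y) * e (take k x) (take k y))"
    by (intro sum.cong refl) (simp add: maj_power_eq)
  finally show ?thesis .
qed

section \<open>Boolean rigidity\<close>

lemma finite_fp_mats: "finite I \<Longrightarrow> finite (fp_mats p I)"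
  by (auto simp: fp_mats_def residue_ring_def intro!: finite_PiE)

text \<open>\<open>LEAST\<close> is meaningful only if some rank is feasible: the point mass at the
  0/1 matrix that represents \<open>B\<close> has no error.\<close>

lemma prob_bool_rank_attained:
  assumes p: "prime p" and B: "\<And>i j. i \<in> I \<Longrightarrow> j \<in> I \<Longrightarrow> B i j \<in> {-1, 1}" and \<delta>: "0 \<le> \<delta>"
  obtains D where "set_pmf D \<subseteq> {L \<in> fp_mats p I. fp_rank p I L \<le> prob_bool_rank p I B \<delta>}"
    "\<And>i j. i \<in> I \<Longrightarrow> j \<in> I \<Longrightarrow> measure_pmf.prob D {L. bool_sign p (L i j) \<noteq> B i j} \<le> \<delta>"
proof -
  define L where "L = (\<lambda>i\<in>I. \<lambda>j\<in>I. if B i j = 1 then 1 else 0 :: int)"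
  have "L \<in> fp_mats p I"
    using prime_gt_1_nat[OF p] by (auto simp: L_def fp_mats_def residue_ring_def)
  moreover have "bool_sign p (L i j) = B i j" if "i \<in> I" "j \<in> I" for i j
    using B[OF that] that by (auto simp: L_def bool_sign_def residue_ring_def)
  ultimately have "\<exists>r D. set_pmf D \<subseteq> {L \<in> fp_mats p I. fp_rank p I L \<le> r} \<and>
      (\<forall>i\<in>I. \<forall>j\<in>I. measure_pmf.prob D {L. bool_sign p (L i j) \<noteq> B i j} \<le> \<delta>)"
    using \<delta> by (intro exI[of _ "fp_rank p I L"] exI[of _ "return_pmf L"]) (auto simp: indicator_def)
  then have "\<exists>D. set_pmf D \<subseteq> {L \<in> fp_mats p I. fp_rank p I L \<le> prob_bool_rank p I B \<delta>} \<and>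
      (\<forall>i\<in>I. \<forall>j\<in>I. measure_pmf.prob D {L. bool_sign p (L i j) \<noteq> B i j} \<le> \<delta>)"
    unfolding prob_bool_rank_def by (rule LeastI_ex)
  then show ?thesis using that by blast
qed

text \<open>Two signs \<open>b\<close> and \<open>b'\<close> disagree
  \<open>(1 - b * b') / 2\<close> times, so the error count of \<open>L\<close> is determined by its
  correlation with \<open>B\<close>.\<close>

lemma bool_rigidity_le:
  assumes "finite I" "L \<in> fp_mats p I" "fp_rank p I L \<le> r"
    and B: "\<And>i j. i \<in> I \<Longrightarrow> j \<in> I \<Longrightarrow> B i j \<in> {-1, 1}"
  shows "real (bool_rigidity p I B r)
    \<le> ((real (card I))\<^sup>2 - (\<Sum>i\<in>I. \<Sum>j\<in>I. real_of_int (B i j) * real_of_int (bool_sign p (L i j)))) / 2"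
proof -
  let ?E = "{(i, j). i \<in> I \<and> j \<in> I \<and> B i j \<noteq> bool_sign p (L i j)}"
  have "bool_rigidity p I B r \<le> card ?E"
    unfolding bool_rigidity_def by (rule Least_le) (use assms in blast)
  moreover have "real (card ?E) = (\<Sum>z\<in>I \<times> I.
      of_bool (B (fst z) (snd z) \<noteq> bool_sign p (L (fst z) (snd z))))"
    using assms(1) by (subst sum_of_bool_eq) (auto intro!: arg_cong[where f = card])
  moreover have "\<dots> = (\<Sum>z\<in>I \<times> I.
      (1 - real_of_int (B (fst z) (snd z)) * real_of_int (bool_sign p (L (fst z) (snd z)))) / 2)"
    by (intro sum.cong refl) (use B in \<open>force simp: bool_sign_def\<close>)
  moreover have "\<dots> = ((real (card I))\<^sup>2 - (\<Sum>i\<in>I. \<Sum>j\<in>I. real_of_int (B i j) * real_of_int (bool_sign p (L i j)))) / 2"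
    unfolding sum.cartesian_product
    by (simp add: sum_divide_distrib[symmetric] sum_subtractf power2_eq_square case_prod_unfold
        card_cartesian_product)
  ultimately show ?thesis by linarith
qed

section \<open>Averaging over the random matrix\<close>

lemma pmf_exists_ge_expectation:
  fixes f :: "'a \<Rightarrow> real"
  assumes "finite (set_pmf D)"
  shows "\<exists>x\<in>set_pmf D. measure_pmf.expectation D f \<le> f x"
proof -
  have "Max (f ` set_pmf D) \<in> f ` set_pmf D"
    using assms set_pmf_not_empty[of D] by (intro Max_in) auto
  then obtain x where x: "x \<in> set_pmf D" "Max (f ` set_pmf D) = f x" by auto
  have "measure_pmf.expectation D f \<le> f x"
    by (rule measure_pmf.integral_le_const)
      (use assms in \<open>auto simp: integrable_measure_pmf_finite AE_measure_pmf_iff x(2)[symmetric]\<close>)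
  then show ?thesis using x by blast
qed

lemma expectation_bool_sign:
  assumes "b \<in> {-1, 1 :: int}"
  shows "real_of_int b * measure_pmf.expectation D (\<lambda>L. real_of_int (bool_sign p (L i j)))
    = 1 - 2 * measure_pmf.prob D {L. bool_sign p (L i j) \<noteq> b}"
proof -
  have "real_of_int b * real_of_int (bool_sign p (L i j))
      = 1 - 2 * indicator {L. bool_sign p (L i j) \<noteq> b} L" for L :: "'a \<Rightarrow> 'b \<Rightarrow> int"
    using assms by (auto simp: bool_sign_def indicator_def)
  then have "measure_pmf.expectation D (\<lambda>L. real_of_int b * real_of_int (bool_sign p (L i j)))
      = measure_pmf.expectation D (\<lambda>L. 1 - 2 * indicator {L. bool_sign p (L i j) \<noteq> b} L)"
    by simp
  also have "\<dots> = 1 - 2 * measure_pmf.prob D {L. bool_sign p (L i j) \<noteq> b}"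
    by (subst Bochner_Integration.integral_diff) (auto simp: less_top[symmetric])
  finally show ?thesis by simp
qed

text \<open>The constant 1/32 is the 1/16 of the correlation bound, halved in passing from
  correlation to error count.\<close>

lemma bool_rigidity_maj_power_le:
  assumes p: "prime p" and A: "\<forall>i<q. \<forall>j<q. A i j \<in> {-1, 1 :: int}"
    and half: "2 * card {(i, j). i < q \<and> j < q \<and> A i j = 1} = q ^ 2"
    and kn: "0 < k" "k < n" and \<delta>: "0 \<le> \<delta>" "\<delta> \<le> 1 / 2"
  shows "real (bool_rigidity p (tuples q n) (maj_power n A)
      (prob_bool_rank p (tuples q k) (maj_power k A) \<delta>))
    \<le> real q ^ (2 * n) * (1 / 2 - 1 / 32 * (1 - 2 * \<delta>) * (sqrt k / sqrt n))"
proof -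
  let ?I = "tuples q k" and ?J = "tuples q n"
  define r where "r = prob_bool_rank p ?I (maj_power k A) \<delta>"
  have B: "maj_power l A x y \<in> {-1, 1}" for l x y by (simp add: maj_power_def maj_def)
  obtain D where D: "set_pmf D \<subseteq> {L \<in> fp_mats p ?I. fp_rank p ?I L \<le> r}"
    and err: "\<And>u v. u \<in> ?I \<Longrightarrow> v \<in> ?I \<Longrightarrow>
      measure_pmf.prob D {L. bool_sign p (L u v) \<noteq> maj_power k A u v} \<le> \<delta>"
    unfolding r_def by (rule prob_bool_rank_attained[OF p _ \<delta>(1), of ?I "maj_power k A"]) (use B in blast)+
  have finD: "finite (set_pmf D)"
    using D by (rule finite_subset[OF order_trans]) (auto simp: finite_fp_mats finite_tuples)
  define e where "e u v = measure_pmf.expectation D (\<lambda>L. real_of_int (bool_sign p (L u v)))" for u v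
  \<comment> \<open>The correlation of the \<open>n\<close>-th majority power with the pullback of
    \<open>L\<close> along truncation.\<close>
  define f where "f L = (\<Sum>x\<in>?J. \<Sum>y\<in>?J.
      real_of_int (maj_power n A x y) * real_of_int (bool_sign p (L (take k x) (take k y))))"
    for L :: "nat list \<Rightarrow> nat list \<Rightarrow> int"
  have "real q ^ (2 * n) * ((1 - 2 * \<delta>) * (sqrt k / (16 * sqrt n)))
      \<le> (\<Sum>x\<in>?J. \<Sum>y\<in>?J. real_of_int (maj_power n A x y) * e (take k x) (take k y))"
  proof (rule maj_power_correlation_ge[OF A half kn])
    show "1 - 2 * \<delta> \<le> real_of_int (maj_power k A u v) * e u v" if "u \<in> ?I" "v \<in> ?I" for u v
      unfolding e_def expectation_bool_sign[OF B] using err[OF that] by simp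
  qed (use \<delta> in simp)
  also have "\<dots> = measure_pmf.expectation D f"
    unfolding f_def e_def by (simp add: integrable_measure_pmf_finite[OF finD])
  \<comment> \<open>Some matrix in the support reaches at least the mean correlation; the support is
    finite because \<open>fp_mats\<close> is.\<close>
  finally obtain L where L: "L \<in> set_pmf D"
    and fL: "real q ^ (2 * n) * ((1 - 2 * \<delta>) * (sqrt k / (16 * sqrt n))) \<le> f L"
    using pmf_exists_ge_expectation[OF finD, of f] by (meson order_trans)
  have take: "take k \<in> ?J \<rightarrow> ?I"
    using kn by (auto simp: tuples_def dest: in_set_takeD)
  let ?L' = "\<lambda>x\<in>?J. \<lambda>y\<in>?J. L (take k x) (take k y)"
  have LI: "L \<in> fp_mats p ?I" "fp_rank p ?I L \<le> r" using L D by auto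
  have "?L' \<in> fp_mats p ?J"
    using LI(1) take by (auto simp: fp_mats_def PiE_iff Pi_iff)
  moreover have "fp_rank p ?J ?L' \<le> r"
    using fp_rank_pullback_le[OF p finite_tuples finite_tuples take LI(1)] LI(2) by simp
  ultimately have "real (bool_rigidity p ?J (maj_power n A) r)
      \<le> ((real (card ?J))\<^sup>2 - (\<Sum>x\<in>?J. \<Sum>y\<in>?J.
        real_of_int (maj_power n A x y) * real_of_int (bool_sign p (?L' x y)))) / 2"
    using B by (intro bool_rigidity_le finite_tuples)
  also have "(\<Sum>x\<in>?J. \<Sum>y\<in>?J. real_of_int (maj_power n A x y) * real_of_int (bool_sign p (?L' x y))) = f L"
    unfolding f_def by (intro sum.cong refl) simp
  also have "(real (card ?J))\<^sup>2 = real q ^ (2 * n)"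
    by (simp add: card_tuples power_mult[symmetric] mult.commute)
  also have "(real q ^ (2 * n) - f L) / 2
      \<le> (real q ^ (2 * n) - real q ^ (2 * n) * ((1 - 2 * \<delta>) * (sqrt k / (16 * sqrt n)))) / 2"
    using fL by (intro divide_right_mono diff_left_mono) auto
  also have "\<dots> = real q ^ (2 * n) * (1 / 2 - 1 / 32 * (1 - 2 * \<delta>) * (sqrt k / sqrt n))"
    using kn by (simp add: field_simps)
  finally show ?thesis by (simp add: r_def)
qed

theorem theorem1p7:
  shows "\<exists>C::real. C > 0 \<and>
    (\<forall>(p::nat) (q::nat) (A :: nat \<Rightarrow> nat \<Rightarrow> int) (k::nat) (n::nat) (\<delta>::real) (r::nat).
       prime p \<longrightarrow> q > 0 \<longrightarrow>
       (\<forall>i<q. \<forall>j<q. A i j \<in> {-1, 1}) \<longrightarrow>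
       2 * card {(i, j). i < q \<and> j < q \<and> A i j = 1} = q ^ 2 \<longrightarrow>
       0 < k \<longrightarrow> k < n \<longrightarrow> 0 < \<delta> \<longrightarrow> \<delta> < 1 / 2 \<longrightarrow>
       prob_bool_rank p (tuples q k) (maj_power k A) \<delta> = r \<longrightarrow>
       real (bool_rigidity p (tuples q n) (maj_power n A) r)
         \<le> real q ^ (2 * n) * (1 / 2 - C * (1 - 2 * \<delta>) * (sqrt (real k) / sqrt (real n))))"
proof (intro exI[of _ "1 / 32"] conjI allI impI)
  fix p q k n r :: nat and A :: "nat \<Rightarrow> nat \<Rightarrow> int" and \<delta> :: real
  assume *: "prime p" "\<forall>i<q. \<forall>j<q. A i j \<in> {-1, 1}"
    "2 * card {(i, j). i < q \<and> j < q \<and> A i j = 1} = q ^ 2" "0 < k" "k < n"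
    and \<delta>: "0 < \<delta>" "\<delta> < 1 / 2"
    and r: "prob_bool_rank p (tuples q k) (maj_power k A) \<delta> = r"
  show "real (bool_rigidity p (tuples q n) (maj_power n A) r)
      \<le> real q ^ (2 * n) * (1 / 2 - 1 / 32 * (1 - 2 * \<delta>) * (sqrt (real k) / sqrt (real n)))"
    using bool_rigidity_maj_power_le[OF *, of \<delta>] \<delta> unfolding r by simp
qed simp

end
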